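(* Let $\mathcal{C}$ be a semi-abelian category and let $H \leq K \leq G$ be subobjects in $\mathcal{C}$. If $H$ is a characteristic subobject of $K$, and $K$ is a characteristic subobject of $G$, then $H$ is characteristic in $G$.
   Context: For an object $B$ of a pointed category $\mathcal{C}$ with finite limits and finite coproducts, let $\mathrm{Pt}_B(\mathcal{C})$ be the category of points over $B$: objects are split epimorphisms $(A,p,s)$ with $p\colon A\to B$, $s\colon B\to A$, $ps=1_B$; morphisms $(A,p,s)\to(A',p',s')$ are arrows $f\colon A\to A'$ with $p'f=p$, $fs=s'$. The functor $\mathrm{Ker}_B\colon \mathrm{Pt}_B(\mathcal{C})\to\mathcal{C}$, $(A,p,s)\mapsto \mathrm{Ker}(p)$, is right adjoint to $B+(-)$, which sends $X$ to the point $(B+X,[1,0],\iota_B)$. The induced monad on $\mathcal{C}$ is denoted $B\flat(-)$, so that $B\flat X$ is the kernel of $[1,0]\colon B+X\to B$. An (internal) action of $B$ on $X$ is an algebra $\xi\colon B\flat X\to X$ for this monad. A subobject $h\colon H\rightarrowtail G$ is called characteristic in $G$ if for every object $B$ and every action $\xi\colon B\flat G\to G$ there exists a (unique) action $\overline{\xi}\colon B\flat H\to H$ with $h\,\overline{\xi}=\xi\,(1_B\flat h)$. *)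

theory Defs
  imports Main
begin

section \<open>Categories and functors\<close>

record ('o, 'm) cat =
  Obj :: "'o set"
  Arr :: "'m set"
  Dom :: "'m \<Rightarrow> 'o"
  Cod :: "'m \<Rightarrow> 'o"
  Ident :: "'o \<Rightarrow> 'm"
  Comp :: "'m \<Rightarrow> 'm \<Rightarrow> 'm"  (infixl "\<cdot>\<index>" 70)

definition hom :: "('o, 'm) cat \<Rightarrow> 'o \<Rightarrow> 'o \<Rightarrow> 'm set" where
  "hom C X Y = {f \<in> Arr C. Dom C f = X \<and> Cod C f = Y}"

locale category =
  fixes C :: "('o, 'm) cat" (structure)
  assumes dom_obj: "f \<in> Arr C \<Longrightarrow> Dom C f \<in> Obj C"
    and cod_obj: "f \<in> Arr C \<Longrightarrow> Cod C f \<in> Obj C"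
    and ident_hom: "X \<in> Obj C \<Longrightarrow> Ident C X \<in> hom C X X"
    and comp_hom: "f \<in> hom C X Y \<Longrightarrow> g \<in> hom C Y Z \<Longrightarrow> g \<cdot> f \<in> hom C X Z"
    and ident_left: "f \<in> hom C X Y \<Longrightarrow> Ident C Y \<cdot> f = f"
    and ident_right: "f \<in> hom C X Y \<Longrightarrow> f \<cdot> Ident C X = f"
    and comp_assoc: "f \<in> hom C W X \<Longrightarrow> g \<in> hom C X Y \<Longrightarrow> h \<in> hom C Y Z
                      \<Longrightarrow> h \<cdot> (g \<cdot> f) = (h \<cdot> g) \<cdot> f"

definition mono_arr :: "('o, 'm) cat \<Rightarrow> 'm \<Rightarrow> bool" where
  "mono_arr C m \<longleftrightarrow> m \<in> Arr C \<and>
     (\<forall>W. \<forall>a \<in> hom C W (Dom C m). \<forall>b \<in> hom C W (Dom C m). m \<cdot>\<^bsub>C\<^esub> a = m \<cdot>\<^bsub>C\<^esub> b \<longrightarrow> a = b)"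

definition iso_arr :: "('o, 'm) cat \<Rightarrow> 'm \<Rightarrow> bool" where
  "iso_arr C f \<longleftrightarrow> f \<in> Arr C \<and>
     (\<exists>g \<in> hom C (Cod C f) (Dom C f).
        g \<cdot>\<^bsub>C\<^esub> f = Ident C (Dom C f) \<and> f \<cdot>\<^bsub>C\<^esub> g = Ident C (Cod C f))"

record ('o, 'm, 'p, 'n) fun_data =
  Fob :: "'o \<Rightarrow> 'p"
  Farr :: "'m \<Rightarrow> 'n"

definition is_functor ::
  "('o, 'm) cat \<Rightarrow> ('p, 'n) cat \<Rightarrow> ('o, 'm, 'p, 'n) fun_data \<Rightarrow> bool" where
  "is_functor C D F \<longleftrightarrow> category C \<and> category D \<and>
     (\<forall>X \<in> Obj C. Fob F X \<in> Obj D \<and> Farr F (Ident C X) = Ident D (Fob F X)) \<and>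
     (\<forall>f \<in> Arr C. Farr F f \<in> hom D (Fob F (Dom C f)) (Fob F (Cod C f))) \<and>
     (\<forall>f \<in> Arr C. \<forall>g \<in> Arr C. Cod C f = Dom C g \<longrightarrow>
        Farr F (g \<cdot>\<^bsub>C\<^esub> f) = Farr F g \<cdot>\<^bsub>D\<^esub> Farr F f)"

definition comp_functor ::
  "('p, 'n, 'q, 'l) fun_data \<Rightarrow> ('o, 'm, 'p, 'n) fun_data \<Rightarrow> ('o, 'm, 'q, 'l) fun_data" where
  "comp_functor G F = \<lparr>Fob = Fob G \<circ> Fob F, Farr = Farr G \<circ> Farr F\<rparr>"

definition reflects_isos ::
  "('o, 'm) cat \<Rightarrow> ('p, 'n) cat \<Rightarrow> ('o, 'm, 'p, 'n) fun_data \<Rightarrow> bool" where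
  "reflects_isos C D F \<longleftrightarrow> (\<forall>f \<in> Arr C. iso_arr D (Farr F f) \<longrightarrow> iso_arr C f)"


section \<open>Limits and colimits\<close>

definition is_cone ::
  "('i, 'j) cat \<Rightarrow> ('o, 'm) cat \<Rightarrow> ('i, 'j, 'o, 'm) fun_data \<Rightarrow> 'o \<Rightarrow> ('i \<Rightarrow> 'm) \<Rightarrow> bool" where
  "is_cone J C D L c \<longleftrightarrow> L \<in> Obj C \<and>
     (\<forall>i \<in> Obj J. c i \<in> hom C L (Fob D i)) \<and>
     (\<forall>j \<in> Arr J. Farr D j \<cdot>\<^bsub>C\<^esub> c (Dom J j) = c (Cod J j))"

definition is_limit ::
  "('i, 'j) cat \<Rightarrow> ('o, 'm) cat \<Rightarrow> ('i, 'j, 'o, 'm) fun_data \<Rightarrow> 'o \<Rightarrow> ('i \<Rightarrow> 'm) \<Rightarrow> bool" where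
  "is_limit J C D L c \<longleftrightarrow> is_cone J C D L c \<and>
     (\<forall>W d. is_cone J C D W d \<longrightarrow>
        (\<exists>!u. u \<in> hom C W L \<and> (\<forall>i \<in> Obj J. c i \<cdot>\<^bsub>C\<^esub> u = d i)))"

text \<open>Every finite category is isomorphic to one whose objects and arrows are natural
  numbers, so quantifying over index categories of that type loses no generality.\<close>

definition has_finite_limits :: "('o, 'm) cat \<Rightarrow> bool" where
  "has_finite_limits C \<longleftrightarrow>
     (\<forall>(J :: (nat, nat) cat) D. category J \<and> finite (Obj J) \<and> finite (Arr J) \<and> is_functor J C D
        \<longrightarrow> (\<exists>L c. is_limit J C D L c))"

definition is_zero_obj :: "('o, 'm) cat \<Rightarrow> 'o \<Rightarrow> bool" where
  "is_zero_obj C Z \<longleftrightarrow> Z \<in> Obj C \<and>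
     (\<forall>X \<in> Obj C. (\<exists>!f. f \<in> hom C X Z) \<and> (\<exists>!f. f \<in> hom C Z X))"

definition pointed :: "('o, 'm) cat \<Rightarrow> bool" where
  "pointed C \<longleftrightarrow> (\<exists>Z. is_zero_obj C Z)"

definition zero_arr :: "('o, 'm) cat \<Rightarrow> 'o \<Rightarrow> 'o \<Rightarrow> 'm" where
  "zero_arr C X Y = (THE f. \<exists>Z a b. is_zero_obj C Z \<and> a \<in> hom C X Z \<and> b \<in> hom C Z Y \<and>
                                f = b \<cdot>\<^bsub>C\<^esub> a)"

definition is_kernel :: "('o, 'm) cat \<Rightarrow> 'm \<Rightarrow> 'm \<Rightarrow> bool" where
  "is_kernel C p k \<longleftrightarrow> p \<in> Arr C \<and> k \<in> Arr C \<and> Cod C k = Dom C p \<and>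
     p \<cdot>\<^bsub>C\<^esub> k = zero_arr C (Dom C k) (Cod C p) \<and>
     (\<forall>W. \<forall>a \<in> hom C W (Dom C p). p \<cdot>\<^bsub>C\<^esub> a = zero_arr C W (Cod C p) \<longrightarrow>
        (\<exists>!u. u \<in> hom C W (Dom C k) \<and> k \<cdot>\<^bsub>C\<^esub> u = a))"

definition ker :: "('o, 'm) cat \<Rightarrow> 'm \<Rightarrow> 'm" where
  "ker C p = (SOME k. is_kernel C p k)"

definition Ker :: "('o, 'm) cat \<Rightarrow> 'm \<Rightarrow> 'o" where
  "Ker C p = Dom C (ker C p)"

definition is_pullback :: "('o, 'm) cat \<Rightarrow> 'm \<Rightarrow> 'm \<Rightarrow> 'm \<Rightarrow> 'm \<Rightarrow> bool" where
  "is_pullback C f g p q \<longleftrightarrow>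
     f \<in> Arr C \<and> g \<in> Arr C \<and> p \<in> Arr C \<and> q \<in> Arr C \<and> Cod C f = Cod C g \<and>
     Dom C p = Dom C q \<and> Cod C p = Dom C f \<and> Cod C q = Dom C g \<and> f \<cdot>\<^bsub>C\<^esub> p = g \<cdot>\<^bsub>C\<^esub> q \<and>
     (\<forall>W. \<forall>a \<in> hom C W (Dom C f). \<forall>b \<in> hom C W (Dom C g). f \<cdot>\<^bsub>C\<^esub> a = g \<cdot>\<^bsub>C\<^esub> b \<longrightarrow>
        (\<exists>!u. u \<in> hom C W (Dom C p) \<and> p \<cdot>\<^bsub>C\<^esub> u = a \<and> q \<cdot>\<^bsub>C\<^esub> u = b))"

definition pb :: "('o, 'm) cat \<Rightarrow> 'm \<Rightarrow> 'm \<Rightarrow> 'm \<times> 'm" where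
  "pb C f g = (SOME (p, q). is_pullback C f g p q)"

definition pb1 :: "('o, 'm) cat \<Rightarrow> 'm \<Rightarrow> 'm \<Rightarrow> 'm" where
  "pb1 C f g = fst (pb C f g)"

definition pb2 :: "('o, 'm) cat \<Rightarrow> 'm \<Rightarrow> 'm \<Rightarrow> 'm" where
  "pb2 C f g = snd (pb C f g)"

definition pb_pair :: "('o, 'm) cat \<Rightarrow> 'm \<Rightarrow> 'm \<Rightarrow> 'm \<Rightarrow> 'm \<Rightarrow> 'm" where
  "pb_pair C f g a b = (THE u. u \<in> hom C (Dom C a) (Dom C (pb1 C f g)) \<and>
                           pb1 C f g \<cdot>\<^bsub>C\<^esub> u = a \<and> pb2 C f g \<cdot>\<^bsub>C\<^esub> u = b)"

definition is_coproduct :: "('o, 'm) cat \<Rightarrow> 'o \<Rightarrow> 'o \<Rightarrow> 'm \<Rightarrow> 'm \<Rightarrow> bool" where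
  "is_coproduct C X Y i j \<longleftrightarrow>
     i \<in> Arr C \<and> j \<in> Arr C \<and> Dom C i = X \<and> Dom C j = Y \<and> Cod C i = Cod C j \<and>
     (\<forall>W. \<forall>f \<in> hom C X W. \<forall>g \<in> hom C Y W.
        (\<exists>!u. u \<in> hom C (Cod C i) W \<and> u \<cdot>\<^bsub>C\<^esub> i = f \<and> u \<cdot>\<^bsub>C\<^esub> j = g))"

definition has_binary_coproducts :: "('o, 'm) cat \<Rightarrow> bool" where
  "has_binary_coproducts C \<longleftrightarrow> (\<forall>X \<in> Obj C. \<forall>Y \<in> Obj C. \<exists>i j. is_coproduct C X Y i j)"

definition coprod_inj :: "('o, 'm) cat \<Rightarrow> 'o \<Rightarrow> 'o \<Rightarrow> 'm \<times> 'm" where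
  "coprod_inj C X Y = (SOME (i, j). is_coproduct C X Y i j)"

definition inj1 :: "('o, 'm) cat \<Rightarrow> 'o \<Rightarrow> 'o \<Rightarrow> 'm" where
  "inj1 C X Y = fst (coprod_inj C X Y)"

definition inj2 :: "('o, 'm) cat \<Rightarrow> 'o \<Rightarrow> 'o \<Rightarrow> 'm" where
  "inj2 C X Y = snd (coprod_inj C X Y)"

definition coprod :: "('o, 'm) cat \<Rightarrow> 'o \<Rightarrow> 'o \<Rightarrow> 'o" where
  "coprod C X Y = Cod C (inj1 C X Y)"

definition copair :: "('o, 'm) cat \<Rightarrow> 'm \<Rightarrow> 'm \<Rightarrow> 'm" where
  "copair C f g = (THE u. u \<in> hom C (coprod C (Dom C f) (Dom C g)) (Cod C f) \<and>
                      u \<cdot>\<^bsub>C\<^esub> inj1 C (Dom C f) (Dom C g) = f \<and>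
                      u \<cdot>\<^bsub>C\<^esub> inj2 C (Dom C f) (Dom C g) = g)"

definition is_coequalizer :: "('o, 'm) cat \<Rightarrow> 'm \<Rightarrow> 'm \<Rightarrow> 'm \<Rightarrow> bool" where
  "is_coequalizer C f g e \<longleftrightarrow>
     f \<in> Arr C \<and> g \<in> Arr C \<and> e \<in> Arr C \<and> Dom C f = Dom C g \<and> Cod C f = Cod C g \<and>
     Dom C e = Cod C f \<and> e \<cdot>\<^bsub>C\<^esub> f = e \<cdot>\<^bsub>C\<^esub> g \<and>
     (\<forall>W. \<forall>a \<in> hom C (Cod C f) W. a \<cdot>\<^bsub>C\<^esub> f = a \<cdot>\<^bsub>C\<^esub> g \<longrightarrow>
        (\<exists>!u. u \<in> hom C (Cod C e) W \<and> u \<cdot>\<^bsub>C\<^esub> e = a))"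


section \<open>Barr-exact categories\<close>

definition regular_epi :: "('o, 'm) cat \<Rightarrow> 'm \<Rightarrow> bool" where
  "regular_epi C e \<longleftrightarrow> (\<exists>f g. is_coequalizer C f g e)"

definition is_kernel_pair :: "('o, 'm) cat \<Rightarrow> 'm \<Rightarrow> 'm \<Rightarrow> 'm \<Rightarrow> bool" where
  "is_kernel_pair C f p q \<longleftrightarrow> is_pullback C f f p q"

definition regular :: "('o, 'm) cat \<Rightarrow> bool" where
  "regular C \<longleftrightarrow> category C \<and> has_finite_limits C \<and>
     (\<forall>f p q. is_kernel_pair C f p q \<longrightarrow> (\<exists>e. is_coequalizer C p q e)) \<and>
     (\<forall>f e p q. is_pullback C f e p q \<and> regular_epi C e \<longrightarrow> regular_epi C p)"

definition equivalence_relation :: "('o, 'm) cat \<Rightarrow> 'o \<Rightarrow> 'o \<Rightarrow> 'm \<Rightarrow> 'm \<Rightarrow> bool" where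
  "equivalence_relation C X R r1 r2 \<longleftrightarrow>
     r1 \<in> hom C R X \<and> r2 \<in> hom C R X \<and>
     (\<forall>W. \<forall>a \<in> hom C W R. \<forall>b \<in> hom C W R.
        r1 \<cdot>\<^bsub>C\<^esub> a = r1 \<cdot>\<^bsub>C\<^esub> b \<and> r2 \<cdot>\<^bsub>C\<^esub> a = r2 \<cdot>\<^bsub>C\<^esub> b \<longrightarrow> a = b) \<and>
     (\<exists>d \<in> hom C X R. r1 \<cdot>\<^bsub>C\<^esub> d = Ident C X \<and> r2 \<cdot>\<^bsub>C\<^esub> d = Ident C X) \<and>
     (\<exists>s \<in> hom C R R. r1 \<cdot>\<^bsub>C\<^esub> s = r2 \<and> r2 \<cdot>\<^bsub>C\<^esub> s = r1) \<and>
     (\<forall>p q. is_pullback C r2 r1 p q \<longrightarrow>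
        (\<exists>t \<in> hom C (Dom C p) R. r1 \<cdot>\<^bsub>C\<^esub> t = r1 \<cdot>\<^bsub>C\<^esub> p \<and> r2 \<cdot>\<^bsub>C\<^esub> t = r2 \<cdot>\<^bsub>C\<^esub> q))"

definition barr_exact :: "('o, 'm) cat \<Rightarrow> bool" where
  "barr_exact C \<longleftrightarrow> regular C \<and>
     (\<forall>X R r1 r2. equivalence_relation C X R r1 r2 \<longrightarrow> (\<exists>f. is_kernel_pair C f r1 r2))"


section \<open>Points and protomodularity\<close>

type_synonym ('o, 'm) point = "'o \<times> 'm \<times> 'm"

definition points :: "('o, 'm) cat \<Rightarrow> 'o \<Rightarrow> ('o, 'm) point set" where
  "points C B = {(A, p, s). p \<in> hom C A B \<and> s \<in> hom C B A \<and> p \<cdot>\<^bsub>C\<^esub> s = Ident C B}"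

text \<open>An arrow of points carries its domain and codomain: the same underlying arrow may
  connect several pairs of points.\<close>

type_synonym ('o, 'm) point_arr = "('o, 'm) point \<times> 'm \<times> ('o, 'm) point"

definition point_arrows :: "('o, 'm) cat \<Rightarrow> 'o \<Rightarrow> ('o, 'm) point_arr set" where
  "point_arrows C B = {((A, p, s), f, (A', p', s')).
     (A, p, s) \<in> points C B \<and> (A', p', s') \<in> points C B \<and>
     f \<in> hom C A A' \<and> p' \<cdot>\<^bsub>C\<^esub> f = p \<and> f \<cdot>\<^bsub>C\<^esub> s = s'}"

definition Pt :: "('o, 'm) cat \<Rightarrow> 'o \<Rightarrow> (('o, 'm) point, ('o, 'm) point_arr) cat" where
  "Pt C B = \<lparr>Obj = points C B, Arr = point_arrows C B,
     Dom = (\<lambda>(P, f, Q). P), Cod = (\<lambda>(P, f, Q). Q),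
     Ident = (\<lambda>(A, p, s). ((A, p, s), Ident C A, (A, p, s))),
     Comp = (\<lambda>(P', g, Q') (P, f, Q). (P, g \<cdot>\<^bsub>C\<^esub> f, Q'))\<rparr>"

definition base_change_obj :: "('o, 'm) cat \<Rightarrow> 'm \<Rightarrow> ('o, 'm) point \<Rightarrow> ('o, 'm) point" where
  "base_change_obj C v = (\<lambda>(A, p, s).
     (Dom C (pb1 C v p), pb1 C v p, pb_pair C v p (Ident C (Dom C v)) (s \<cdot>\<^bsub>C\<^esub> v)))"

definition base_change ::
  "('o, 'm) cat \<Rightarrow> 'm \<Rightarrow>
    (('o, 'm) point, ('o, 'm) point_arr, ('o, 'm) point, ('o, 'm) point_arr) fun_data" where
  "base_change C v =
     \<lparr>Fob = base_change_obj C v,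
      Farr = (\<lambda>((A, p, s), f, (A', p', s')).
        (base_change_obj C v (A, p, s),
         pb_pair C v p' (pb1 C v p) (f \<cdot>\<^bsub>C\<^esub> pb2 C v p),
         base_change_obj C v (A', p', s')))\<rparr>"

definition protomodular :: "('o, 'm) cat \<Rightarrow> bool" where
  "protomodular C \<longleftrightarrow> (\<forall>E B. \<forall>v \<in> hom C E B. reflects_isos (Pt C B) (Pt C E) (base_change C v))"

definition semi_abelian :: "('o, 'm) cat \<Rightarrow> bool" where
  "semi_abelian C \<longleftrightarrow>
     category C \<and> pointed C \<and> has_binary_coproducts C \<and> barr_exact C \<and> protomodular C"


section \<open>Monads and their algebras\<close>

record ('o, 'm) monad_data =
  endo :: "('o, 'm, 'o, 'm) fun_data"
  unit_at :: "'o \<Rightarrow> 'm"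
  mult_at :: "'o \<Rightarrow> 'm"

text \<open>The monad of an adjunction with left adjoint \<open>F\<close>, right adjoint \<open>U\<close>,
  unit \<open>\<eta>\<close> and counit \<open>\<epsilon>\<close>.\<close>

definition induced_monad ::
  "('o, 'm, 'p, 'n) fun_data \<Rightarrow> ('p, 'n, 'o, 'm) fun_data \<Rightarrow> ('o \<Rightarrow> 'm) \<Rightarrow> ('p \<Rightarrow> 'n)
    \<Rightarrow> ('o, 'm) monad_data" where
  "induced_monad F U \<eta> \<epsilon> =
     \<lparr>endo = comp_functor U F, unit_at = \<eta>, mult_at = (\<lambda>X. Farr U (\<epsilon> (Fob F X)))\<rparr>"

definition is_algebra :: "('o, 'm) cat \<Rightarrow> ('o, 'm) monad_data \<Rightarrow> 'o \<Rightarrow> 'm \<Rightarrow> bool" where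
  "is_algebra C T X \<xi> \<longleftrightarrow> X \<in> Obj C \<and> \<xi> \<in> hom C (Fob (endo T) X) X \<and>
     \<xi> \<cdot>\<^bsub>C\<^esub> unit_at T X = Ident C X \<and>
     \<xi> \<cdot>\<^bsub>C\<^esub> mult_at T X = \<xi> \<cdot>\<^bsub>C\<^esub> Farr (endo T) \<xi>"


section \<open>Internal actions and characteristic subobjects\<close>

definition Ker_functor ::
  "('o, 'm) cat \<Rightarrow> (('o, 'm) point, ('o, 'm) point_arr, 'o, 'm) fun_data" where
  "Ker_functor C =
     \<lparr>Fob = (\<lambda>(A, p, s). Ker C p),
      Farr = (\<lambda>((A, p, s), f, (A', p', s')).
        THE u. u \<in> hom C (Ker C p) (Ker C p') \<and> ker C p' \<cdot>\<^bsub>C\<^esub> u = f \<cdot>\<^bsub>C\<^esub> ker C p)\<rparr>"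

definition sum_point :: "('o, 'm) cat \<Rightarrow> 'o \<Rightarrow> 'o \<Rightarrow> ('o, 'm) point" where
  "sum_point C B X = (coprod C B X, copair C (Ident C B) (zero_arr C X B), inj1 C B X)"

definition sum_functor ::
  "('o, 'm) cat \<Rightarrow> 'o \<Rightarrow> ('o, 'm, ('o, 'm) point, ('o, 'm) point_arr) fun_data" where
  "sum_functor C B =
     \<lparr>Fob = sum_point C B,
      Farr = (\<lambda>f. (sum_point C B (Dom C f),
                    copair C (inj1 C B (Cod C f)) (inj2 C B (Cod C f) \<cdot>\<^bsub>C\<^esub> f),
                    sum_point C B (Cod C f)))\<rparr>"

text \<open>Unit and counit of the adjunction between \<open>B + (-)\<close> and \<open>Ker\<^sub>B\<close>: the unit at \<open>X\<close>
  is the factorisation of the second injection through the kernel of \<open>[1, 0]\<close>, the counit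
  at \<open>(A, p, s)\<close> is \<open>[s, ker p] : B + Ker p \<rightarrow> A\<close>.\<close>

definition flat_unit :: "('o, 'm) cat \<Rightarrow> 'o \<Rightarrow> 'o \<Rightarrow> 'm" where
  "flat_unit C B X =
     (let \<kappa> = ker C (copair C (Ident C B) (zero_arr C X B))
      in THE u. u \<in> hom C X (Dom C \<kappa>) \<and> \<kappa> \<cdot>\<^bsub>C\<^esub> u = inj2 C B X)"

definition flat_counit :: "('o, 'm) cat \<Rightarrow> 'o \<Rightarrow> ('o, 'm) point \<Rightarrow> ('o, 'm) point_arr" where
  "flat_counit C B = (\<lambda>(A, p, s). (sum_point C B (Ker C p), copair C s (ker C p), (A, p, s)))"

definition flat_monad :: "('o, 'm) cat \<Rightarrow> 'o \<Rightarrow> ('o, 'm) monad_data" where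
  "flat_monad C B =
     induced_monad (sum_functor C B) (Ker_functor C) (flat_unit C B) (flat_counit C B)"

definition is_action :: "('o, 'm) cat \<Rightarrow> 'o \<Rightarrow> 'o \<Rightarrow> 'm \<Rightarrow> bool" where
  "is_action C B X \<xi> \<longleftrightarrow> is_algebra C (flat_monad C B) X \<xi>"

definition flat_map :: "('o, 'm) cat \<Rightarrow> 'o \<Rightarrow> 'm \<Rightarrow> 'm" where
  "flat_map C B f = Farr (endo (flat_monad C B)) f"

definition subobject :: "('o, 'm) cat \<Rightarrow> 'm \<Rightarrow> 'o \<Rightarrow> 'o \<Rightarrow> bool" where
  "subobject C h H G \<longleftrightarrow> h \<in> hom C H G \<and> mono_arr C h"

definition characteristic :: "('o, 'm) cat \<Rightarrow> 'm \<Rightarrow> 'o \<Rightarrow> 'o \<Rightarrow> bool" where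
  "characteristic C h H G \<longleftrightarrow> subobject C h H G \<and>
     (\<forall>B \<in> Obj C. \<forall>\<xi>. is_action C B G \<xi> \<longrightarrow>
        (\<exists>!\<xi>'. is_action C B H \<xi>' \<and> h \<cdot>\<^bsub>C\<^esub> \<xi>' = \<xi> \<cdot>\<^bsub>C\<^esub> flat_map C B h))"

end

theory Submission
  imports Defs
begin

text \<open>Restricting an action along \<open>k\<close> and then along \<open>h\<close> restricts it along \<open>k h\<close>, because
  \<open>B\<flat>(-)\<close> preserves composition; the restriction is unique because \<open>k h\<close> is monic. Functoriality
  comes from the universal properties of coproducts and of kernels, the latter being obtained
  as equalizers with the zero arrow.\<close>

section \<open>Typing of arrows and composition of monomorphisms\<close>

lemma (in category) hom_objs:
  assumes "f \<in> hom C X Y"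
  shows "X \<in> Obj C" "Y \<in> Obj C"
  using assms dom_obj cod_obj unfolding hom_def by blast+

lemma (in category) mono_arr_comp:
  assumes "f \<in> hom C X Y" "mono_arr C f" "g \<in> hom C Y Z" "mono_arr C g"
  shows "mono_arr C (g \<cdot> f)"
proof -
  have gf: "g \<cdot> f \<in> hom C X Z"
    using assms by (blast intro: comp_hom)
  have "a = b" if "a \<in> hom C W X" "b \<in> hom C W X" "g \<cdot> f \<cdot> a = g \<cdot> f \<cdot> b" for W a b
  proof -
    have "g \<cdot> (f \<cdot> a) = g \<cdot> (f \<cdot> b)"
      using that assms comp_assoc by metis
    then have "f \<cdot> a = f \<cdot> b"
      using assms(1,3,4) that(1,2) comp_hom unfolding mono_arr_def hom_def
      by (smt (verit, best) mem_Collect_eq)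
    then show ?thesis
      using assms(1,2) that(1,2) unfolding mono_arr_def hom_def by auto
  qed
  with gf show ?thesis
    unfolding mono_arr_def by (auto simp: hom_def)
qed

section \<open>Zero objects and zero arrows\<close>

lemma zero_objD:
  assumes "is_zero_obj C Z"
  shows "Z \<in> Obj C"
    and "X \<in> Obj C \<Longrightarrow> \<exists>!f. f \<in> hom C X Z"
    and "X \<in> Obj C \<Longrightarrow> \<exists>!f. f \<in> hom C Z X"
  using assms by (simp_all add: is_zero_obj_def)

text \<open>\<open>zero_arr\<close> is a definite description ranging over all zero objects, so it
  has a value only once every factorization is known to give the same arrow. Two zero objects are
  linked by a unique arrow, and this makes the composites agree.\<close>

lemma (in category) zero_arr_eqI:
  assumes Z: "is_zero_obj C Z" and a: "a \<in> hom C X Z" and b: "b \<in> hom C Z Y"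
  shows "zero_arr C X Y = b \<cdot> a"
  unfolding zero_arr_def
proof (rule the_equality)
  show "\<exists>Z a' b'. is_zero_obj C Z \<and> a' \<in> hom C X Z \<and> b' \<in> hom C Z Y \<and> b \<cdot> a = b' \<cdot> a'"
    using assms by blast
next
  fix f
  assume "\<exists>Z a b. is_zero_obj C Z \<and> a \<in> hom C X Z \<and> b \<in> hom C Z Y \<and> f = b \<cdot> a"
  then obtain Z' a' b' where Z': "is_zero_obj C Z'" and a': "a' \<in> hom C X Z'"
    and b': "b' \<in> hom C Z' Y" and f: "f = b' \<cdot> a'"
    by blast
  have X: "X \<in> Obj C" and Y: "Y \<in> Obj C"
    using hom_objs a b by blast+
  \<comment> \<open>The comparison arrow between the two zero objects. Uniqueness of arrows into
    \<open>Z'\<close> gives the triangle with \<open>a\<close> and \<open>a'\<close>; uniqueness of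
    arrows out of \<open>Z\<close> gives the one with \<open>b\<close> and
    \<open>b'\<close>.\<close>
  obtain z where z: "z \<in> hom C Z Z'"
    using zero_objD(2)[OF Z' zero_objD(1)[OF Z]] by (elim ex1E)
  have "z \<cdot> a = a'"
    using zero_objD(2)[OF Z' X] comp_hom[OF a z] a' by (elim ex1E) metis
  moreover have "b' \<cdot> z = b"
    using zero_objD(3)[OF Z Y] comp_hom[OF z b'] b by (elim ex1E) metis
  ultimately show "f = b \<cdot> a"
    using f comp_assoc[OF a z b'] by simp
qed

lemma (in category) zero_arr_factor:
  assumes "pointed C" "X \<in> Obj C" "Y \<in> Obj C"
  obtains Z a b where "is_zero_obj C Z" "a \<in> hom C X Z" "b \<in> hom C Z Y" "zero_arr C X Y = b \<cdot> a"
proof -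
  obtain Z where Z: "is_zero_obj C Z"
    using assms(1) by (auto simp: pointed_def)
  obtain a where a: "a \<in> hom C X Z"
    using zero_objD(2)[OF Z assms(2)] by (elim ex1E)
  obtain b where b: "b \<in> hom C Z Y"
    using zero_objD(3)[OF Z assms(3)] by (elim ex1E)
  show ?thesis
    using that[OF Z a b zero_arr_eqI[OF Z a b]] .
qed

lemma (in category) zero_arr_hom:
  assumes "pointed C" "X \<in> Obj C" "Y \<in> Obj C"
  shows "zero_arr C X Y \<in> hom C X Y"
  using zero_arr_factor[OF assms] comp_hom by metis

text \<open>A factorization \<open>b \<cdot> a\<close> through a zero object stays one after
  precomposition, with \<open>a \<cdot> f\<close> as its first factor.\<close>

lemma (in category) zero_arr_comp:
  assumes "pointed C" "f \<in> hom C W X" "Y \<in> Obj C"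
  shows "zero_arr C X Y \<cdot> f = zero_arr C W Y"
proof -
  have "X \<in> Obj C"
    using hom_objs assms(2) by blast
  then obtain Z a b where Z: "is_zero_obj C Z" and a: "a \<in> hom C X Z" and b: "b \<in> hom C Z Y"
    and eq: "zero_arr C X Y = b \<cdot> a"
    using zero_arr_factor assms(1,3) by blast
  have "zero_arr C W Y = b \<cdot> (a \<cdot> f)"
    using zero_arr_eqI[OF Z comp_hom[OF assms(2) a] b] .
  then show ?thesis
    using eq comp_assoc[OF assms(2) a b] by simp
qed

section \<open>Equalizers from finite limits\<close>

text \<open>Arrows \<open>0\<close> and \<open>1\<close> are the identities; \<open>2\<close> and \<open>3\<close> are the two parallel arrows.\<close>

definition parallel_pair :: "(nat, nat) cat" where
  "parallel_pair = \<lparr>Obj = {0, 1}, Arr = {0, 1, 2, 3},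
     Dom = (\<lambda>f. if f = 1 then 1 else 0), Cod = (\<lambda>f. if f = 0 then 0 else 1),
     Ident = (\<lambda>X. X), Comp = (\<lambda>g f. if f < 2 then g else f)\<rparr>"

text \<open>In a composable pair, either the right factor is an identity (\<open>f < 2\<close>), and
  the composite is \<open>g\<close>, or it is one of the two parallel arrows; then \<open>g\<close>
  has to be the identity of \<open>1\<close>, and the composite is \<open>f\<close>.\<close>

lemma category_parallel_pair: "category parallel_pair"
proof (unfold_locales, goal_cases)
  case (4 f X Y g Z)
  then show ?case
    by (auto simp: parallel_pair_def hom_def)
qed (auto simp: parallel_pair_def hom_def)

lemma (in category) equalizer_exists:
  assumes lim: "has_finite_limits C" and f: "f \<in> hom C X Y" and g: "g \<in> hom C X Y"
  obtains L e where "e \<in> hom C L X" "f \<cdot> e = g \<cdot> e"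
    "\<And>W a. a \<in> hom C W X \<Longrightarrow> f \<cdot> a = g \<cdot> a \<Longrightarrow> \<exists>!u. u \<in> hom C W L \<and> e \<cdot> u = a"
proof -
  \<comment> \<open>The diagram sends the arrows \<open>2\<close> and \<open>3\<close> to
    \<open>f\<close> and \<open>g\<close>, so that its limit is their equalizer.\<close>
  define D :: "(nat, nat, 'o, 'm) fun_data" where
    "D = \<lparr>Fob = (\<lambda>i. if i = 0 then X else Y),
          Farr = (\<lambda>j. if j = 0 then Ident C X else if j = 1 then Ident C Y
                      else if j = 2 then f else g)\<rparr>"
  have XY: "X \<in> Obj C" "Y \<in> Obj C"
    using hom_objs[OF f] by simp_all
  note ids = ident_hom[OF XY(1)] ident_hom[OF XY(2)]
  have "category C"
    by unfold_locales
  then have "is_functor parallel_pair C D"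
    unfolding is_functor_def
    using category_parallel_pair XY f g ids
    by (auto simp: D_def parallel_pair_def ident_left ident_right
        ident_left[OF ids(1)] ident_left[OF ids(2)] ident_left[OF f] ident_left[OF g]
        ident_right[OF f] ident_right[OF g])
  moreover have "finite (Obj parallel_pair)" "finite (Arr parallel_pair)"
    by (simp_all add: parallel_pair_def)
  ultimately obtain L c where lc: "is_limit parallel_pair C D L c"
    using lim category_parallel_pair unfolding has_finite_limits_def by meson
  \<comment> \<open>The identities impose no condition, so a cone is an arrow \<open>d 0\<close>
    equalizing \<open>f\<close> and \<open>g\<close>, together with the common composite as
    \<open>d 1\<close>.\<close>
  have cone_iff: "is_cone parallel_pair C D W d \<longleftrightarrow>
      W \<in> Obj C \<and> d 0 \<in> hom C W X \<and> d 1 \<in> hom C W Y \<and> f \<cdot> d 0 = d 1 \<and> g \<cdot> d 0 = d 1" for W d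
    unfolding is_cone_def by (auto simp: D_def parallel_pair_def ident_left)
  have c: "L \<in> Obj C" "c 0 \<in> hom C L X" "c 1 \<in> hom C L Y" "f \<cdot> c 0 = c 1" "g \<cdot> c 0 = c 1"
    using lc unfolding is_limit_def cone_iff by auto
  have "\<exists>!u. u \<in> hom C W L \<and> c 0 \<cdot> u = a" if a: "a \<in> hom C W X" and eq: "f \<cdot> a = g \<cdot> a" for W a
  proof -
    let ?d = "\<lambda>i :: nat. if i = 0 then a else f \<cdot> a"
    have "is_cone parallel_pair C D W ?d"
      unfolding cone_iff using a eq comp_hom[OF a f] hom_objs[OF a] by auto
    then have "\<exists>!u. u \<in> hom C W L \<and> (\<forall>i \<in> Obj parallel_pair. c i \<cdot> u = ?d i)"
      using lc unfolding is_limit_def by blast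
    \<comment> \<open>The leg at \<open>1\<close> is \<open>f\<close> after the leg at
      \<open>0\<close>, both in the limit cone and in \<open>?d\<close>; hence only the equation at
      \<open>0\<close> has content.\<close>
    moreover have "(\<forall>i \<in> Obj parallel_pair. c i \<cdot> u = ?d i) \<longleftrightarrow> c 0 \<cdot> u = a"
      if "u \<in> hom C W L" for u
      using comp_assoc[OF that c(2) f] c(4) by (auto simp: parallel_pair_def)
    ultimately show ?thesis
      by (simp cong: conj_cong)
  qed
  with c show ?thesis
    by (intro that[of "c 0" L]) auto
qed

section \<open>Kernels and functoriality of \<open>Ker_functor\<close>\<close>

lemma is_kernelD:
  assumes "is_kernel C p k" "p \<in> hom C A B"
  shows "k \<in> hom C (Dom C k) A"
    and "p \<cdot>\<^bsub>C\<^esub> k = zero_arr C (Dom C k) B"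
    and "a \<in> hom C W A \<Longrightarrow> p \<cdot>\<^bsub>C\<^esub> a = zero_arr C W B \<Longrightarrow>
           \<exists>!u. u \<in> hom C W (Dom C k) \<and> k \<cdot>\<^bsub>C\<^esub> u = a"
proof -
  have "Dom C p = A" "Cod C p = B"
    using assms(2) by (auto simp: hom_def)
  with assms(1) show "k \<in> hom C (Dom C k) A"
    and "p \<cdot>\<^bsub>C\<^esub> k = zero_arr C (Dom C k) B"
    by (simp_all add: is_kernel_def hom_def)
  show "\<exists>!u. u \<in> hom C W (Dom C k) \<and> k \<cdot>\<^bsub>C\<^esub> u = a"
    if "a \<in> hom C W A" "p \<cdot>\<^bsub>C\<^esub> a = zero_arr C W B"
    using assms(1) that \<open>Dom C p = A\<close> \<open>Cod C p = B\<close> by (simp add: is_kernel_def)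
qed

text \<open>The equalizer of \<open>p\<close> with the zero arrow is a kernel, since precomposing
  the zero arrow gives a zero arrow again. As \<open>ker\<close> is a choice, the existence of one
  kernel suffices.\<close>

lemma (in category) is_kernel_ker:
  assumes "has_finite_limits C" "pointed C" "p \<in> hom C A B"
  shows "is_kernel C p (ker C p)"
proof -
  have AB: "A \<in> Obj C" "B \<in> Obj C"
    using hom_objs[OF assms(3)] by simp_all
  obtain L e where e: "e \<in> hom C L A" "p \<cdot> e = zero_arr C A B \<cdot> e"
    and univ: "\<And>W a. a \<in> hom C W A \<Longrightarrow> p \<cdot> a = zero_arr C A B \<cdot> a
                 \<Longrightarrow> \<exists>!u. u \<in> hom C W L \<and> e \<cdot> u = a"
    by (rule equalizer_exists[OF assms(1,3) zero_arr_hom[OF assms(2) AB]]) metis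
  have "is_kernel C p e"
    unfolding is_kernel_def
    using e univ assms(3) zero_arr_comp[OF assms(2) _ AB(2)] by (auto simp: hom_def)
  then show ?thesis
    unfolding ker_def by (rule someI)
qed

lemma (in category) ker_hom:
  assumes "has_finite_limits C" "pointed C" "p \<in> hom C A B"
  shows "ker C p \<in> hom C (Ker C p) A"
  unfolding Ker_def using is_kernelD(1)[OF is_kernel_ker[OF assms] assms(3)] .

text \<open>As \<open>p' \<cdot> f = p\<close>, the arrow \<open>f \<cdot> ker C p\<close> is
  annihilated by \<open>p'\<close> and factors uniquely through \<open>ker C p'\<close>. This makes
  the definite description in \<open>Ker_functor\<close> meaningful.\<close>

lemma (in category) ker_map_unique:
  assumes "has_finite_limits C" "pointed C" "p \<in> hom C A B" "p' \<in> hom C A' B"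
    and "f \<in> hom C A A'" "p' \<cdot> f = p"
  shows "\<exists>!u. u \<in> hom C (Ker C p) (Ker C p') \<and> ker C p' \<cdot> u = f \<cdot> ker C p"
proof -
  have k: "ker C p \<in> hom C (Ker C p) A"
    using ker_hom assms by blast
  have "p' \<cdot> (f \<cdot> ker C p) = p \<cdot> ker C p"
    using comp_assoc[OF k assms(5,4)] assms(6) by simp
  also have "\<dots> = zero_arr C (Ker C p) B"
    unfolding Ker_def by (rule is_kernelD(2)[OF is_kernel_ker[OF assms(1-3)] assms(3)])
  finally show ?thesis
    using is_kernelD(3)[OF is_kernel_ker[OF assms(1,2,4)] assms(4) comp_hom[OF k assms(5)]]
    by (simp add: Ker_def)
qed

text \<open>The composite of the two induced arrows is a factorization of
  \<open>g \<cdot> f \<cdot> ker C p\<close> through \<open>ker C p''\<close>, and there is only one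
  such factorization. The second conclusion supplies the typing that associativity asks for
  later.\<close>

lemma (in category) Ker_functor_comp:
  assumes "has_finite_limits C" "pointed C"
    and "((A, p, s), f, (A', p', s')) \<in> point_arrows C B"
    and "((A', p', s'), g, (A'', p'', s'')) \<in> point_arrows C B"
  shows "Farr (Ker_functor C) ((A, p, s), g \<cdot> f, (A'', p'', s'')) =
    Farr (Ker_functor C) ((A', p', s'), g, (A'', p'', s'')) \<cdot>
    Farr (Ker_functor C) ((A, p, s), f, (A', p', s'))"
    and "Farr (Ker_functor C) ((A, p, s), f, (A', p', s')) \<in> hom C (Ker C p) (Ker C p')"
proof -
  have p: "p \<in> hom C A B" "p' \<in> hom C A' B" "p'' \<in> hom C A'' B"
    and f: "f \<in> hom C A A'" "p' \<cdot> f = p" and g: "g \<in> hom C A' A''" "p'' \<cdot> g = p'"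
    using assms(3,4) by (auto simp: point_arrows_def points_def)
  have gf: "g \<cdot> f \<in> hom C A A''" "p'' \<cdot> (g \<cdot> f) = p"
    using comp_hom[OF f(1) g(1)] comp_assoc[OF f(1) g(1) p(3)] f g by auto
  note U = ker_map_unique[OF assms(1,2)]
  define u where "u = Farr (Ker_functor C) ((A, p, s), f, (A', p', s'))"
  define v where "v = Farr (Ker_functor C) ((A', p', s'), g, (A'', p'', s''))"
  have u: "u \<in> hom C (Ker C p) (Ker C p')" "ker C p' \<cdot> u = f \<cdot> ker C p"
    using theI'[OF U[OF p(1,2) f]] by (auto simp: u_def Ker_functor_def)
  have v: "v \<in> hom C (Ker C p') (Ker C p'')" "ker C p'' \<cdot> v = g \<cdot> ker C p'"
    using theI'[OF U[OF p(2,3) g]] by (auto simp: v_def Ker_functor_def)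
  note ks = ker_hom[OF assms(1,2) p(1)] ker_hom[OF assms(1,2) p(2)] ker_hom[OF assms(1,2) p(3)]
  have "ker C p'' \<cdot> (v \<cdot> u) = g \<cdot> ker C p' \<cdot> u"
    using comp_assoc[OF u(1) v(1) ks(3)] v by simp
  also have "\<dots> = g \<cdot> f \<cdot> ker C p"
    using comp_assoc[OF u(1) ks(2) g(1)] u comp_assoc[OF ks(1) f(1) g(1)] by simp
  finally have "v \<cdot> u \<in> hom C (Ker C p) (Ker C p'') \<and> ker C p'' \<cdot> (v \<cdot> u) = g \<cdot> f \<cdot> ker C p"
    using comp_hom[OF u(1) v(1)] by simp
  from the1_equality[OF U[OF p(1,3) gf] this]
  show "Farr (Ker_functor C) ((A, p, s), g \<cdot> f, (A'', p'', s'')) = v \<cdot> u"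
    by (simp add: Ker_functor_def)
  show "u \<in> hom C (Ker C p) (Ker C p')"
    by (rule u)
qed

section \<open>Binary coproducts and copairing\<close>

lemma is_coproduct_inj:
  assumes "has_binary_coproducts C" "X \<in> Obj C" "Y \<in> Obj C"
  shows "is_coproduct C X Y (inj1 C X Y) (inj2 C X Y)"
proof -
  have "\<exists>q. case q of (i, j) \<Rightarrow> is_coproduct C X Y i j"
    using assms unfolding has_binary_coproducts_def by auto
  then have "case coprod_inj C X Y of (i, j) \<Rightarrow> is_coproduct C X Y i j"
    unfolding coprod_inj_def by (rule someI_ex)
  then show ?thesis
    by (simp add: inj1_def inj2_def split_beta)
qed

lemma inj_hom:
  assumes "has_binary_coproducts C" "X \<in> Obj C" "Y \<in> Obj C"
  shows "inj1 C X Y \<in> hom C X (coprod C X Y)" "inj2 C X Y \<in> hom C Y (coprod C X Y)"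
  using is_coproduct_inj[OF assms] by (auto simp: is_coproduct_def coprod_def hom_def)

lemma (in category) copair_unique:
  assumes "has_binary_coproducts C" "f \<in> hom C X W" "g \<in> hom C Y W"
  shows "\<exists>!u. u \<in> hom C (coprod C X Y) W \<and> u \<cdot> inj1 C X Y = f \<and> u \<cdot> inj2 C X Y = g"
proof -
  have "X \<in> Obj C" "Y \<in> Obj C"
    using hom_objs assms(2,3) by blast+
  then have "is_coproduct C X Y (inj1 C X Y) (inj2 C X Y)"
    by (rule is_coproduct_inj[OF assms(1)])
  with assms(2,3) show ?thesis
    unfolding is_coproduct_def coprod_def by blast
qed

lemma (in category) copair:
  assumes "has_binary_coproducts C" "f \<in> hom C X W" "g \<in> hom C Y W"
  shows "copair C f g \<in> hom C (coprod C X Y) W"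
    and "copair C f g \<cdot> inj1 C X Y = f" and "copair C f g \<cdot> inj2 C X Y = g"
proof -
  have "Dom C f = X" "Cod C f = W" "Dom C g = Y"
    using assms(2,3) by (auto simp: hom_def)
  then have "copair C f g =
      (THE u. u \<in> hom C (coprod C X Y) W \<and> u \<cdot> inj1 C X Y = f \<and> u \<cdot> inj2 C X Y = g)"
    by (simp add: copair_def)
  with theI'[OF copair_unique[OF assms]]
  show "copair C f g \<in> hom C (coprod C X Y) W"
    and "copair C f g \<cdot> inj1 C X Y = f" and "copair C f g \<cdot> inj2 C X Y = g"
    by auto
qed

text \<open>Both sides have the same composites with the two injections, so the uniqueness of
  copairings identifies them.\<close>

lemma (in category) comp_copair:
  assumes cop: "has_binary_coproducts C" and f: "f \<in> hom C X W" and g: "g \<in> hom C Y W"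
    and w: "w \<in> hom C W V"
  shows "w \<cdot> copair C f g = copair C (w \<cdot> f) (w \<cdot> g)"
proof -
  have XY: "X \<in> Obj C" "Y \<in> Obj C"
    using hom_objs f g by blast+
  note i = inj_hom[OF cop XY]
  note c = copair[OF cop f g]
  note c' = copair[OF cop comp_hom[OF f w] comp_hom[OF g w]]
  show ?thesis
    using copair_unique[OF cop comp_hom[OF f w] comp_hom[OF g w]] comp_hom[OF c(1) w]
      comp_assoc[OF i(1) c(1) w] comp_assoc[OF i(2) c(1) w] c c'
    by metis
qed

section \<open>Functoriality of the sum with \<open>B\<close> and of \<open>flat_map\<close>\<close>

text \<open>The underlying arrow is 1 + f. Its being an arrow of points is what allows
  \<open>Ker_functor_comp\<close> to be applied to it.\<close>

lemma (in category) sum_functor_arr: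
  assumes cop: "has_binary_coproducts C" and pt: "pointed C"
    and B: "B \<in> Obj C" and f: "f \<in> hom C X Y"
  shows "Farr (sum_functor C B) f \<in> point_arrows C B"
proof -
  have XY: "X \<in> Obj C" "Y \<in> Obj C" "Dom C f = X" "Cod C f = Y"
    using hom_objs[OF f] f by (simp_all add: hom_def)
  note iX = inj_hom[OF cop B XY(1)] and iY = inj_hom[OF cop B XY(2)]
  note idB = ident_hom[OF B]
  note zX = zero_arr_hom[OF pt XY(1) B] and zY = zero_arr_hom[OF pt XY(2) B]
  note pX = copair[OF cop idB zX] and pY = copair[OF cop idB zY]
  note m = copair[OF cop iY(1) comp_hom[OF f iY(2)]]
  \<comment> \<open>Compatibility with the projections: [1,0] after 1 + f has components 1 and 0 f =
    0. Compatibility with the sections is the first copairing equation of \<open>m\<close>.\<close>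
  have "copair C (Ident C B) (zero_arr C Y B) \<cdot> copair C (inj1 C B Y) (inj2 C B Y \<cdot> f) =
      copair C (Ident C B) (zero_arr C X B)"
    using comp_copair[OF cop iY(1) comp_hom[OF f iY(2)] pY(1)] pY
      comp_assoc[OF f iY(2) pY(1)] zero_arr_comp[OF pt f B] by simp
  then show ?thesis
    using iX iY pX pY m XY
    by (simp add: sum_functor_def sum_point_def point_arrows_def points_def)
qed

text \<open>\<open>flat_map\<close> is the kernel functor applied to 1 + f. The identity (1 + g)(1 +
  f) = 1 + g f holds by \<open>comp_copair\<close>, and taking kernels preserves this
  composite.\<close>

lemma (in category) flat_map_comp:
  assumes lim: "has_finite_limits C" and cop: "has_binary_coproducts C" and pt: "pointed C"
    and B: "B \<in> Obj C" and f: "f \<in> hom C X Y" and g: "g \<in> hom C Y Z"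
  shows "flat_map C B (g \<cdot> f) = flat_map C B g \<cdot> flat_map C B f"
    and "flat_map C B f \<in> hom C (Fob (endo (flat_monad C B)) X) (Fob (endo (flat_monad C B)) Y)"
proof -
  have O: "X \<in> Obj C" "Y \<in> Obj C" "Z \<in> Obj C" "Dom C f = X" "Cod C f = Y" "Dom C g = Y" "Cod C g = Z"
    using hom_objs[OF f] hom_objs[OF g] f g by (simp_all add: hom_def)
  note gf = comp_hom[OF f g]
  have [simp]: "Dom C (g \<cdot> f) = X" "Cod C (g \<cdot> f) = Z"
    using gf by (auto simp: hom_def)
  note iY = inj_hom[OF cop B O(2)] and iZ = inj_hom[OF cop B O(3)]
  note m = copair[OF cop iZ(1) comp_hom[OF g iZ(2)]]
  have comp: "copair C (inj1 C B Z) (inj2 C B Z \<cdot> g) \<cdot> copair C (inj1 C B Y) (inj2 C B Y \<cdot> f) =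
      copair C (inj1 C B Z) (inj2 C B Z \<cdot> (g \<cdot> f))"
    using comp_copair[OF cop iY(1) comp_hom[OF f iY(2)] m(1)] m
      comp_assoc[OF f iY(2) m(1)] comp_assoc[OF f g iZ(2)] by simp
  note arrs = sum_functor_arr[OF cop pt B f] sum_functor_arr[OF cop pt B g]
  \<comment> \<open>Unfolding exposes the points as explicit triples, the form in which
    \<open>Ker_functor_comp\<close> expects them.\<close>
  note K = Ker_functor_comp[OF lim pt arrs[unfolded sum_functor_def sum_point_def, simplified O,
    simplified, unfolded O]]
  show "flat_map C B (g \<cdot> f) = flat_map C B g \<cdot> flat_map C B f"
    using K(1) comp O
    by (simp add: flat_map_def flat_monad_def induced_monad_def comp_functor_def
        sum_functor_def sum_point_def)
  show "flat_map C B f \<in> hom C (Fob (endo (flat_monad C B)) X) (Fob (endo (flat_monad C B)) Y)"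
    using K(2) O
    by (simp add: flat_map_def flat_monad_def induced_monad_def comp_functor_def
        sum_functor_def sum_point_def Ker_functor_def)
qed

section \<open>Transitivity of characteristic subobjects\<close>

lemma is_action_hom:
  assumes "is_action C B X \<xi>"
  shows "\<xi> \<in> hom C (Fob (endo (flat_monad C B)) X) X"
  using assms by (simp add: is_action_def is_algebra_def)

theorem proposition2p3:
  fixes C :: "('o, 'm) cat" and H K G :: 'o and h k :: 'm
  assumes "semi_abelian C"
    and "subobject C h H K" and "subobject C k K G"
    and "characteristic C h H K" and "characteristic C k K G"
  shows "characteristic C (k \<cdot>\<^bsub>C\<^esub> h) H G"
proof -
  interpret category C
    using assms(1) by (simp add: semi_abelian_def)
  have lim: "has_finite_limits C" and cop: "has_binary_coproducts C" and pt: "pointed C"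
    using assms(1) by (auto simp: semi_abelian_def barr_exact_def regular_def)
  have h: "h \<in> hom C H K" "mono_arr C h" and k: "k \<in> hom C K G" "mono_arr C k"
    using assms(2,3) by (auto simp: subobject_def)
  have kh: "k \<cdot>\<^bsub>C\<^esub> h \<in> hom C H G" "mono_arr C (k \<cdot>\<^bsub>C\<^esub> h)"
    using comp_hom[OF h(1) k(1)] mono_arr_comp[OF h k] .
  have "\<exists>!\<xi>'. is_action C B H \<xi>' \<and> (k \<cdot>\<^bsub>C\<^esub> h) \<cdot>\<^bsub>C\<^esub> \<xi>' = \<xi> \<cdot>\<^bsub>C\<^esub> flat_map C B (k \<cdot>\<^bsub>C\<^esub> h)"
    if B: "B \<in> Obj C" and \<xi>: "is_action C B G \<xi>" for B \<xi>
  proof (rule ex_ex1I)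
    \<comment> \<open>The action \<xi> on \<open>G\<close> restricts along \<open>k\<close> to
      \<zeta> on \<open>K\<close>, which in turn restricts along \<open>h\<close> to \<theta> on
      \<open>H\<close>.\<close>
    obtain \<zeta> where \<zeta>: "is_action C B K \<zeta>" "k \<cdot>\<^bsub>C\<^esub> \<zeta> = \<xi> \<cdot>\<^bsub>C\<^esub> flat_map C B k"
      using assms(5) B \<xi> unfolding characteristic_def by blast
    obtain \<theta> where \<theta>: "is_action C B H \<theta>" "h \<cdot>\<^bsub>C\<^esub> \<theta> = \<zeta> \<cdot>\<^bsub>C\<^esub> flat_map C B h"
      using assms(4) B \<zeta>(1) unfolding characteristic_def by blast
    have G: "G \<in> Obj C"
      using hom_objs[OF k(1)] by simp
    note Fh = flat_map_comp[OF lim cop pt B h(1) k(1)]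
    \<comment> \<open>The typing of \<open>flat_map C B k\<close> comes from a lemma about
      composable pairs; the identity of \<open>G\<close> serves as the second arrow.\<close>
    note Fk = flat_map_comp(2)[OF lim cop pt B k(1) ident_hom[OF G]]
    note acts = is_action_hom[OF \<xi>] is_action_hom[OF \<zeta>(1)] is_action_hom[OF \<theta>(1)]
    have "(k \<cdot>\<^bsub>C\<^esub> h) \<cdot>\<^bsub>C\<^esub> \<theta> = k \<cdot>\<^bsub>C\<^esub> (\<zeta> \<cdot>\<^bsub>C\<^esub> flat_map C B h)"
      using comp_assoc[OF acts(3) h(1) k(1)] \<theta>(2) by simp
    also have "\<dots> = (\<xi> \<cdot>\<^bsub>C\<^esub> flat_map C B k) \<cdot>\<^bsub>C\<^esub> flat_map C B h"
      using comp_assoc[OF Fh(2) acts(2) k(1)] \<zeta>(2) by simp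
    also have "\<dots> = \<xi> \<cdot>\<^bsub>C\<^esub> flat_map C B (k \<cdot>\<^bsub>C\<^esub> h)"
      using comp_assoc[OF Fh(2) Fk acts(1)] Fh(1) by simp
    finally show "\<exists>\<xi>'. is_action C B H \<xi>' \<and>
        (k \<cdot>\<^bsub>C\<^esub> h) \<cdot>\<^bsub>C\<^esub> \<xi>' = \<xi> \<cdot>\<^bsub>C\<^esub> flat_map C B (k \<cdot>\<^bsub>C\<^esub> h)"
      using \<theta>(1) by blast
  next
    fix \<alpha> \<beta>
    assume "is_action C B H \<alpha> \<and> (k \<cdot>\<^bsub>C\<^esub> h) \<cdot>\<^bsub>C\<^esub> \<alpha> = \<xi> \<cdot>\<^bsub>C\<^esub> flat_map C B (k \<cdot>\<^bsub>C\<^esub> h)"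
      and "is_action C B H \<beta> \<and> (k \<cdot>\<^bsub>C\<^esub> h) \<cdot>\<^bsub>C\<^esub> \<beta> = \<xi> \<cdot>\<^bsub>C\<^esub> flat_map C B (k \<cdot>\<^bsub>C\<^esub> h)"
    \<comment> \<open>Cancelling the monomorphism \<open>k h\<close> requires \<alpha> and \<beta>
      to be arrows into its domain, which is therefore identified with \<open>H\<close>.\<close>
    moreover have "Dom C (k \<cdot>\<^bsub>C\<^esub> h) = H"
      using kh(1) by (simp add: hom_def)
    ultimately show "\<alpha> = \<beta>"
      using kh(2) is_action_hom unfolding mono_arr_def by metis
  qed
  with kh show ?thesis
    by (simp add: characteristic_def subobject_def)
qed

end
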